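(* Let $M$ be any $\mathsf{n}$-Smullyan model. (1) The following are equivalent: (mG1) for any $M$-predicate $H$ satisfying $\Phi_M(H)\subseteq\mathrm{True}_M$, there exists $S\in\mathrm{Sent}_M$ such that $M\models S$ and $S\notin\Phi_M(H)$; (G1) for any $M$-predicate $H$ satisfying $\Phi_M(H)\subseteq\mathrm{True}_M$, there exists $S\in\mathrm{Sent}_M$ such that $S\notin\Phi_M(H)$ and $\mathsf{n}S\notin\Phi_M(H)$. (2) The following are equivalent: (mG1$^+$) for any $M$-predicate $H$ satisfying $\Phi_M(H)\cap\mathrm{Sent}_M^+\subseteq\mathrm{True}_M^+$, there exists $S\in\mathrm{Sent}_M^+$ such that $M\models S$ and $S\notin\Phi_M(H)$; (G1$^+$) for any $M$-predicate $H$ satisfying $\Phi_M(H)\cap\mathrm{Sent}_M^+\subseteq\mathrm{True}_M^+$, there exists $S\in\mathrm{Sent}_M^+$ such that $S\notin\Phi_M(H)$ and $\mathsf{n}S\notin\Phi_M(H)$.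
   Context: For a non-empty set $\Sigma$ of symbols, $\Sigma^\ast$ is the set of all finite strings over $\Sigma$, including the empty string $\epsilon$; $XY$ denotes concatenation. A Smullyan model is a triple $M=(\Sigma_M,\mathrm{Pred}_M,\Phi_M)$ where $\Sigma_M$ is a non-empty set of symbols, $\mathrm{Pred}_M\subseteq\Sigma_M^\ast$ is such that $HX\notin \mathrm{Pred}_M$ for all $H\in\mathrm{Pred}_M$ and $X\in\Sigma_M^\ast\setminus\{\epsilon\}$, and $\Phi_M:\mathrm{Pred}_M\to\mathcal{P}(\Sigma_M^\ast)$ is a function. Elements of $\mathrm{Pred}_M$ are called $M$-predicates. $\mathrm{Sent}_M=\{HX : H\in\mathrm{Pred}_M, X\in\Sigma_M^\ast\}$ is the set of $M$-sentences (the decomposition $HX$ of an $M$-sentence is unique), and $\mathrm{Sent}_M^+=\mathrm{Sent}_M\setminus\mathrm{Pred}_M$. $\mathrm{True}_M=\{HX\in \mathrm{Sent}_M : H\in\mathrm{Pred}_M, X\in\Phi_M(H)\}$ and $\mathrm{True}_M^+=\mathrm{True}_M\cap\mathrm{Sent}_M^+$. For an $M$-sentence $S$, write $M\models S$ if $S\in\mathrm{True}_M$. Let $\mathsf{n}$ be a fixed symbol. A Smullyan model $M$ is an $\mathsf{n}$-Smullyan model if $\mathsf{n}\in\Sigma_M$ and for each $H\in\mathrm{Pred}_M$ we have $\mathsf{n}H\in\mathrm{Pred}_M$ and $\Phi_M(\mathsf{n}H)=\Sigma_M^\ast\setminus\Phi_M(H)$. *)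

theory Defs
  imports Main
begin

text \<open>Strings over a set of symbols \<open>\<Sigma>\<close> are the elements of \<open>lists \<Sigma>\<close>.
  \<open>Phi\<close> is a total HOL function, of which only the values on \<open>Pred\<close> are relevant.\<close>

record 'a smullyan =
  Sig :: "'a set"
  Pred :: "'a list set"
  Phi :: "'a list \<Rightarrow> 'a list set"

definition smullyan_model :: "'a smullyan \<Rightarrow> bool" where
  "smullyan_model M \<longleftrightarrow>
     Sig M \<noteq> {} \<and>
     Pred M \<subseteq> lists (Sig M) \<and>
     (\<forall>H\<in>Pred M. \<forall>X\<in>lists (Sig M) - {[]}. H @ X \<notin> Pred M) \<and>
     (\<forall>H\<in>Pred M. Phi M H \<subseteq> lists (Sig M))"

definition Sent :: "'a smullyan \<Rightarrow> 'a list set" where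
  "Sent M = {H @ X | H X. H \<in> Pred M \<and> X \<in> lists (Sig M)}"

definition Sent_plus :: "'a smullyan \<Rightarrow> 'a list set" where
  "Sent_plus M = Sent M - Pred M"

definition True_sent :: "'a smullyan \<Rightarrow> 'a list set" where
  "True_sent M = {H @ X | H X. H @ X \<in> Sent M \<and> H \<in> Pred M \<and> X \<in> Phi M H}"

definition True_sent_plus :: "'a smullyan \<Rightarrow> 'a list set" where
  "True_sent_plus M = True_sent M \<inter> Sent_plus M"

definition smullyan_models :: "'a smullyan \<Rightarrow> 'a list \<Rightarrow> bool" (infix "\<Turnstile>" 50) where
  "M \<Turnstile> S \<longleftrightarrow> S \<in> True_sent M"

definition n_smullyan_model :: "'a \<Rightarrow> 'a smullyan \<Rightarrow> bool" where
  "n_smullyan_model n M \<longleftrightarrow>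
     smullyan_model M \<and>
     n \<in> Sig M \<and>
     (\<forall>H\<in>Pred M. n # H \<in> Pred M \<and> Phi M (n # H) = lists (Sig M) - Phi M H)"

end

theory Submission
  imports Defs
begin

text \<open>The map \<open>S \<mapsto> nS\<close> sends sentences to sentences, preserves \<open>Sent_plus\<close>, and negates
  truth, because the decomposition of a sentence is unique. So for a sound \<open>P\<close>, a true sentence \<open>S\<close>
  outside \<open>P\<close> is undecided by \<open>P\<close> since \<open>nS\<close> is false; conversely, if \<open>S\<close> is undecided by \<open>P\<close>,
  then one of \<open>S\<close>, \<open>nS\<close> is a true sentence outside \<open>P\<close>.\<close>

text \<open>Two predicates that begin the same string are comparable as prefixes, and no predicate
  properly extends another.\<close>

lemma pred_append_unique:
  assumes M: "smullyan_model M"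
    and H: "H \<in> Pred M" "H' \<in> Pred M"
    and X: "X \<in> lists (Sig M)" "X' \<in> lists (Sig M)"
    and eq: "H @ X = H' @ X'"
  shows "H = H' \<and> X = X'"
proof -
  have prefix: "Y = []" if "K \<in> Pred M" "K @ Y \<in> Pred M" "Y \<in> lists (Sig M)" for K Y
    using M that unfolding smullyan_model_def by blast
  from eq obtain Y where "H = H' @ Y \<and> Y @ X = X' \<or> H @ Y = H' \<and> X = Y @ X'"
    by (auto simp: append_eq_append_conv2)
  then show ?thesis
    using prefix H X by fastforce
qed

lemma append_in_True_sent_iff:
  assumes "smullyan_model M" "H \<in> Pred M" "X \<in> lists (Sig M)"
  shows "H @ X \<in> True_sent M \<longleftrightarrow> X \<in> Phi M H"
proof -
  \<comment> \<open>Puts a witness taken from \<open>True_sent\<close> over the alphabet, so that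
    uniqueness of decomposition applies to it.\<close>
  have "Phi M K \<subseteq> lists (Sig M)" if "K \<in> Pred M" for K
    using assms(1) that unfolding smullyan_model_def by blast
  then show ?thesis
    using assms pred_append_unique[of M] unfolding True_sent_def Sent_def by blast
qed

lemma n_smullyan_modelD:
  assumes "n_smullyan_model n M"
  shows "smullyan_model M"
    and "H \<in> Pred M \<Longrightarrow> n # H \<in> Pred M"
    and "H \<in> Pred M \<Longrightarrow> Phi M (n # H) = lists (Sig M) - Phi M H"
  using assms unfolding n_smullyan_model_def by auto

lemma Cons_in_Sent:
  assumes "n_smullyan_model n M" "S \<in> Sent M"
  shows "n # S \<in> Sent M"
  using assms(2) n_smullyan_modelD(2)[OF assms(1)] unfolding Sent_def
  by (force simp flip: append_Cons)

text \<open>Prefixing \<open>n\<close> to \<open>H @ X\<close> keeps the argument \<open>X\<close>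
  and changes the predicate to \<open>n # H\<close>, whose extension is the complement.\<close>

lemma Cons_in_True_sent_iff:
  assumes M: "n_smullyan_model n M" and S: "S \<in> Sent M"
  shows "n # S \<in> True_sent M \<longleftrightarrow> S \<notin> True_sent M"
proof -
  from S obtain H X where HX: "S = H @ X" "H \<in> Pred M" "X \<in> lists (Sig M)"
    unfolding Sent_def by blast
  then show ?thesis
    using append_in_True_sent_iff[of M "n # H" X] append_in_True_sent_iff[of M H X]
      n_smullyan_modelD[OF M]
    by simp
qed

text \<open>Since \<open>S\<close> is not a predicate, its argument \<open>X\<close> is nonempty;
  hence \<open>n # S\<close> properly extends the predicate \<open>n # H\<close> and is no predicate
  either.\<close>

lemma Cons_in_Sent_plus:
  assumes M: "n_smullyan_model n M" and S: "S \<in> Sent_plus M"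
  shows "n # S \<in> Sent_plus M"
proof -
  from S obtain H X where HX: "S = H @ X" "H \<in> Pred M" "X \<in> lists (Sig M)" "S \<notin> Pred M"
    unfolding Sent_plus_def Sent_def by blast
  then have "X \<noteq> []"
    by auto
  then have "(n # H) @ X \<notin> Pred M"
    using HX n_smullyan_modelD[OF M] unfolding smullyan_model_def by blast
  then show ?thesis
    using Cons_in_Sent[OF M] S HX(1) unfolding Sent_plus_def by simp
qed

text \<open>Keeping \<open>A\<close> abstract serves both parts of the theorem, with
  \<open>A\<close> as \<open>Sent M\<close> and as \<open>Sent_plus M\<close>; soundness of
  \<open>P\<close> is needed only inside \<open>A\<close>.\<close>

lemma true_unprovable_iff_undecidable:
  assumes M: "n_smullyan_model n M"
    and A: "A \<subseteq> Sent M" "\<And>S. S \<in> A \<Longrightarrow> n # S \<in> A"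
    and sound: "P \<inter> A \<subseteq> True_sent M"
  shows "(\<exists>S\<in>A. M \<Turnstile> S \<and> S \<notin> P) \<longleftrightarrow> (\<exists>S\<in>A. S \<notin> P \<and> n # S \<notin> P)"
proof -
  have "n # S \<in> True_sent M \<longleftrightarrow> S \<notin> True_sent M" if "S \<in> A" for S
    using Cons_in_True_sent_iff[OF M] A(1) that by blast
  then show ?thesis
    using A(2) sound unfolding smullyan_models_def by blast
qed

theorem proposition3p5:
  fixes n :: 'a and M :: "'a smullyan"
  assumes "n_smullyan_model n M"
  shows "((\<forall>H\<in>Pred M. Phi M H \<subseteq> True_sent M \<longrightarrow>
             (\<exists>S\<in>Sent M. M \<Turnstile> S \<and> S \<notin> Phi M H))
          \<longleftrightarrow>
          (\<forall>H\<in>Pred M. Phi M H \<subseteq> True_sent M \<longrightarrow>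
             (\<exists>S\<in>Sent M. S \<notin> Phi M H \<and> n # S \<notin> Phi M H)))
       \<and>
         ((\<forall>H\<in>Pred M. Phi M H \<inter> Sent_plus M \<subseteq> True_sent_plus M \<longrightarrow>
             (\<exists>S\<in>Sent_plus M. M \<Turnstile> S \<and> S \<notin> Phi M H))
          \<longleftrightarrow>
          (\<forall>H\<in>Pred M. Phi M H \<inter> Sent_plus M \<subseteq> True_sent_plus M \<longrightarrow>
             (\<exists>S\<in>Sent_plus M. S \<notin> Phi M H \<and> n # S \<notin> Phi M H)))"
proof -
  note n_closed = Cons_in_Sent[OF assms] Cons_in_Sent_plus[OF assms]
  have plus_subset: "Sent_plus M \<subseteq> Sent M"
    unfolding Sent_plus_def by blast
  have "(\<exists>S\<in>Sent M. M \<Turnstile> S \<and> S \<notin> P) \<longleftrightarrow> (\<exists>S\<in>Sent M. S \<notin> P \<and> n # S \<notin> P)"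
    if "P \<subseteq> True_sent M" for P
    by (rule true_unprovable_iff_undecidable[OF assms]) (use that n_closed in auto)
  moreover have "(\<exists>S\<in>Sent_plus M. M \<Turnstile> S \<and> S \<notin> P) \<longleftrightarrow>
      (\<exists>S\<in>Sent_plus M. S \<notin> P \<and> n # S \<notin> P)"
    if "P \<inter> Sent_plus M \<subseteq> True_sent_plus M" for P
    by (rule true_unprovable_iff_undecidable[OF assms plus_subset])
      (use that n_closed in \<open>auto simp: True_sent_plus_def\<close>)
  ultimately show ?thesis
    \<comment> \<open>Both equivalences are conditional on soundness; \<open>imp_cong\<close> makes
      that premise available while the existential after it is rewritten.\<close>
    by (simp cong: imp_cong)
qed

end
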